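(* Let $P$ be a rational polytope in $\mathbb{R}^d$ such that $Q := \sum_{\gamma \in \mathsf{B}_d} [\gamma P]$ multi-tiles $\mathbb{R}^d$ by integer translations. Then $A_P(t) = \mathrm{vol}(P)t^d$ for all positive integers $t$.
   Context: A polytope is the convex hull of finitely many points; it is rational if its vertices have rational coordinates. $\mathsf{B}_d$ is the hyperoctahedral group: the group of symmetries of the cube $[-1,1]^d$, i.e. the $2^dd!$ signed permutation matrices acting linearly on $\mathbb{R}^d$. Polytope group: the abelian group formally generated by the symbols $[A]$, where $A$ runs over all subsets of $\mathbb{R}^d$ that are unions of finitely many polytopes with disjoint interiors, subject to $[A]+[B]=[A\cup B]$ whenever $A$ and $B$ have disjoint interiors. Additive functions such as $A\mapsto\mathrm{vol}(A)$ or $A\mapsto\mathbf{1}_A\in L^1(\mathbb{R}^d)$ extend linearly to this group. In particular, $\mathbf{1}_Q=\sum_{\gamma\in\mathsf{B}_d}\mathbf{1}_{\gamma P}$ almost everywhere. An element $Q$ of the polytope group multi-tiles $\mathbb{R}^d$ by integer translations if there is an integer $k$ such that $\sum_{\lambda\in\mathbb{Z}^d}\mathbf{1}_Q(x-\lambda)=k$ for almost every $x\in\mathbb{R}^d$. Solid angle: $\omega_P(x)=\lim_{\epsilon\to0^+}\mathrm{vol}(B(x,\epsilon)\cap P)/\mathrm{vol}(B(x,\epsilon))$, with $B(x,\epsilon)$ the ball of center $x$ and radius $\epsilon$. Solid angle sum: $A_P(t)=\sum_{x\in\mathbb{Z}^d}\omega_{tP}(x)$, where $tP=\{tx:x\in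 P\}$. *)

theory Defs
  imports "HOL-Analysis.Analysis" "HOL-Algebra.Free_Abelian_Groups"
begin

definition integer_lattice :: "(real^'n) set" where
  "integer_lattice = {x. \<forall>i. x $ i \<in> \<int>}"

definition rational_polytope :: "(real^'n) set \<Rightarrow> bool" where
  "rational_polytope P \<longleftrightarrow> polytope P \<and> (\<forall>v. v extreme_point_of P \<longrightarrow> (\<forall>i. v $ i \<in> \<rat>))"

definition hyperoctahedral :: "(real^'n^'n) set" where
  "hyperoctahedral =
     {M. \<exists>p s. p permutes UNIV \<and> (\<forall>i. s i \<in> {-1, 1}) \<and>
               M = (\<chi> i j. if j = p i then s i else 0)}"

lemma card_hyperoctahedral:
  "card (hyperoctahedral :: (real^'n^'n) set) = 2 ^ CARD('n) * fact CARD('n)"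
proof -
  let ?f = "\<lambda>(p, s). (\<chi> i j. if j = p i then s i else 0) :: real^'n^'n"
  let ?S = "{s :: 'n \<Rightarrow> real. \<forall>i. s i \<in> {-1, 1}}"
  let ?D = "{p :: 'n \<Rightarrow> 'n. p permutes UNIV} \<times> ?S"
  have "?S = Pi\<^sub>E UNIV (\<lambda>_. {-1, 1})" by auto
  then have S: "card ?S = 2 ^ CARD('n)"
    by (simp add: card_PiE numeral_2_eq_2)
  have "inj_on ?f ?D"
  proof (rule inj_onI, clarify)
    fix p q :: "'n \<Rightarrow> 'n" and s u :: "'n \<Rightarrow> real"
    assume s: "\<forall>i. s i \<in> {-1, 1}" and u: "\<forall>i. u i \<in> {-1, 1}"
      and eq: "(\<chi> i j. if j = p i then s i else 0) = (\<chi> i j. if j = q i then u i else 0)"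
    have *: "(if j = p i then s i else 0) = (if j = q i then u i else 0)" for i j
      using arg_cong[OF eq, of "\<lambda>M. M $ i $ j"] by simp
    have "s i \<noteq> 0" for i using s[rule_format, of i] by auto
    then have "p i = q i \<and> s i = u i" for i
      using *[of "p i" i] by (metis (full_types))
    then show "p = q \<and> s = u" by auto
  qed
  moreover have "hyperoctahedral = ?f ` ?D"
    by (auto simp: hyperoctahedral_def image_iff)
  ultimately have "card (hyperoctahedral :: (real^'n^'n) set) = card ?D"
    by (metis (no_types, lifting) card_image)
  then show ?thesis
    using card_permutations[of "UNIV :: 'n set"] S by (simp add: card_cartesian_product)
qed

(* A finprod over an infinite set would be trivial. *)
lemma finite_hyperoctahedral: "finite (hyperoctahedral :: (real^'n^'n) set)"
  by (rule card_ge_0_finite) (simp add: card_hyperoctahedral)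


section \<open>The polytope group\<close>

definition polytope_unions :: "(real^'n) set set" where
  "polytope_unions =
     {\<Union>F | F. finite F \<and> (\<forall>S\<in>F. polytope S) \<and>
            pairwise (\<lambda>S T. interior S \<inter> interior T = {}) F}"

definition polytope_relations :: "((real^'n) set \<Rightarrow>\<^sub>0 int) set" where
  "polytope_relations =
     {frag_of A + frag_of B - frag_of (A \<union> B) | A B.
        A \<in> polytope_unions \<and> B \<in> polytope_unions \<and> interior A \<inter> interior B = {}}"

definition polytope_relation_subgroup :: "((real^'n) set \<Rightarrow>\<^sub>0 int) set" where
  "polytope_relation_subgroup =
     generate (free_Abelian_group polytope_unions) polytope_relations"

(* The group operation, which is addition in the text, is written multiplicatively in HOL-Algebra;
   in particular finite sums of its elements are finprod. *)
definition polytope_group :: "((real^'n) set \<Rightarrow>\<^sub>0 int) set monoid" where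
  "polytope_group = free_Abelian_group polytope_unions Mod polytope_relation_subgroup"

definition polytope_class :: "(real^'n) set \<Rightarrow> ((real^'n) set \<Rightarrow>\<^sub>0 int) set" where
  "polytope_class A = polytope_relation_subgroup #>\<^bsub>free_Abelian_group polytope_unions\<^esub> frag_of A"

lemma polytope_unions_Un:
  assumes "A \<in> polytope_unions" "B \<in> polytope_unions" "interior A \<inter> interior B = {}"
  shows "A \<union> B \<in> polytope_unions"
proof -
  obtain F where F: "A = \<Union>F" "finite F" "\<forall>S\<in>F. polytope S"
      "pairwise (\<lambda>S T. interior S \<inter> interior T = {}) F"
    using assms(1) by (auto simp: polytope_unions_def)
  obtain G where G: "B = \<Union>G" "finite G" "\<forall>S\<in>G. polytope S"
      "pairwise (\<lambda>S T. interior S \<inter> interior T = {}) G"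
    using assms(2) by (auto simp: polytope_unions_def)
  have "interior S \<inter> interior T = {}" if "S \<in> F" "T \<in> G" for S T
  proof -
    have "interior S \<subseteq> interior A" "interior T \<subseteq> interior B"
      using that F(1) G(1) by (auto intro!: interior_mono)
    then show ?thesis using assms(3) by blast
  qed
  then have "pairwise (\<lambda>S T. interior S \<inter> interior T = {}) (F \<union> G)"
    using F(4) G(4) unfolding pairwise_def by blast
  moreover have "A \<union> B = \<Union>(F \<union> G)" using F(1) G(1) by auto
  ultimately show ?thesis
    unfolding polytope_unions_def using F(2,3) G(2,3)
    by (intro CollectI exI[of _ "F \<union> G"]) auto
qed

lemma polytope_in_polytope_unions: "polytope P \<Longrightarrow> P \<in> polytope_unions"
  unfolding polytope_unions_def by (intro CollectI exI[of _ "{P}"]) auto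

lemma polytope_relations_subset:
  "polytope_relations \<subseteq> carrier (free_Abelian_group polytope_unions)"
proof -
  have "Poly_Mapping.keys (frag_of A + frag_of B - frag_of (A \<union> B)) \<subseteq> polytope_unions"
    if "A \<in> polytope_unions" "B \<in> polytope_unions" "interior A \<inter> interior B = {}"
    for A B :: "(real^'n) set"
  proof -
    have "Poly_Mapping.keys (frag_of A + frag_of B - frag_of (A \<union> B)) \<subseteq> {A, B, A \<union> B}"
      using keys_diff[of "frag_of A + frag_of B" "frag_of (A \<union> B)"]
        Poly_Mapping.keys_add[of "frag_of A" "frag_of B"] by (auto split: if_splits)
    then show ?thesis using that polytope_unions_Un[OF that] by auto
  qed
  then show ?thesis unfolding polytope_relations_def by fastforce
qed

lemma polytope_relation_subgroup:
  "subgroup polytope_relation_subgroup (free_Abelian_group polytope_unions)"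
  unfolding polytope_relation_subgroup_def
  by (intro group.generate_is_subgroup group_free_Abelian_group polytope_relations_subset)

lemma comm_group_polytope_group: "comm_group polytope_group"
  unfolding polytope_group_def
  by (intro comm_group.abelian_FactGroup abelian_free_Abelian_group polytope_relation_subgroup)


section \<open>Indicator functions of elements of the polytope group\<close>

definition frag_indicator :: "((real^'n) set \<Rightarrow>\<^sub>0 int) \<Rightarrow> real^'n \<Rightarrow> real" where
  "frag_indicator c x =
     (\<Sum>A\<in>Poly_Mapping.keys c. of_int (Poly_Mapping.lookup c A) * indicator A x)"

(* The linear extension of the map taking A to the class of its indicator function in L^1: we pick
   a function representing this class; see polytope_group_indicator_AE for the independence of
   the choice up to null sets. *)
definition polytope_group_indicator :: "((real^'n) set \<Rightarrow>\<^sub>0 int) set \<Rightarrow> real^'n \<Rightarrow> real" where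
  "polytope_group_indicator Q = frag_indicator (SOME c. c \<in> Q)"

lemma frag_indicator_superset:
  assumes "finite K" "Poly_Mapping.keys c \<subseteq> K"
  shows "frag_indicator c x = (\<Sum>A\<in>K. of_int (Poly_Mapping.lookup c A) * indicator A x)"
  unfolding frag_indicator_def
  by (rule sum.mono_neutral_left) (use assms in \<open>auto simp: in_keys_iff\<close>)

lemma frag_indicator_add: "frag_indicator (c + d) x = frag_indicator c x + frag_indicator d x"
proof -
  let ?K = "Poly_Mapping.keys c \<union> Poly_Mapping.keys d"
  have *: "finite ?K" by simp
  show ?thesis
    using Poly_Mapping.keys_add[of c d]
    by (simp add: frag_indicator_superset[OF *] lookup_add sum.distrib distrib_right)
qed

lemma frag_indicator_uminus: "frag_indicator (- c) x = - frag_indicator c x"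
  by (simp add: frag_indicator_def sum_negf)

lemma frag_indicator_diff: "frag_indicator (c - d) x = frag_indicator c x - frag_indicator d x"
  using frag_indicator_add[of c "- d" x] frag_indicator_uminus[of d x] by simp

lemma frag_indicator_of: "frag_indicator (frag_of A) x = indicator A x"
  by (simp add: frag_indicator_def)

lemma negligible_frontier_polytope_union:
  assumes "A \<in> polytope_unions"
  shows "negligible (frontier A)" "closed A"
proof -
  obtain F where F: "A = \<Union>F" "finite F" "\<forall>S\<in>F. polytope S"
    using assms by (auto simp: polytope_unions_def)
  show "closed A" unfolding F(1) by (rule closed_Union) (use F(2,3) polytope_imp_closed in auto)
  have "negligible (\<Union>(frontier ` F))"
    using F by (intro negligible_Union) (auto intro!: negligible_convex_frontier polytope_imp_convex)
  moreover have "frontier A \<subseteq> \<Union>(frontier ` F)"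
    using frontier_Union_subset[OF F(2)] F(1) by blast
  ultimately show "negligible (frontier A)" by (rule negligible_subset)
qed

lemma AE_frag_indicator_relation:
  assumes "c \<in> polytope_relations"
  shows "AE x in lebesgue. frag_indicator c x = 0"
proof -
  obtain A B where c: "c = frag_of A + frag_of B - frag_of (A \<union> B)"
    and AB: "A \<in> polytope_unions" "B \<in> polytope_unions" "interior A \<inter> interior B = {}"
    using assms by (auto simp: polytope_relations_def)
  note fr = negligible_frontier_polytope_union[OF AB(1)] negligible_frontier_polytope_union[OF AB(2)]
  have "negligible (frontier A \<union> frontier B)" using fr by (intro negligible_Un)
  then have "frontier A \<union> frontier B \<in> null_sets lebesgue" by (simp add: negligible_iff_null_sets)
  then have "AE x in lebesgue. x \<notin> frontier A \<union> frontier B" by (rule AE_not_in)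
  then show ?thesis
  proof eventually_elim
    case (elim x)
    have "\<not> (x \<in> A \<and> x \<in> B)"
      using elim fr(2,4) AB(3) by (auto simp: frontier_def)
    then show ?case
      by (auto simp: c frag_indicator_add frag_indicator_diff frag_indicator_of indicator_def)
  qed
qed

lemma AE_frag_indicator_relation_subgroup:
  assumes "c \<in> polytope_relation_subgroup"
  shows "AE x in lebesgue. frag_indicator c x = 0"
  using assms unfolding polytope_relation_subgroup_def
proof (induction rule: generate.induct)
  case one
  then show ?case by (simp add: frag_indicator_def)
next
  case (incl h)
  then show ?case by (rule AE_frag_indicator_relation)
next
  case (inv h)
  then have "Poly_Mapping.keys h \<subseteq> polytope_unions" using polytope_relations_subset by fastforce
  then show ?case
    using AE_frag_indicator_relation[OF inv] by (simp add: frag_indicator_uminus)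
next
  case (eng h1 h2)
  from eng.IH show ?case by eventually_elim (simp add: frag_indicator_add)
qed

lemma polytope_group_indicator_AE:
  assumes "Q \<in> carrier polytope_group" "c \<in> Q"
  shows "AE x in lebesgue. polytope_group_indicator Q x = frag_indicator c x"
proof -
  obtain a where Q: "Q = polytope_relation_subgroup #>\<^bsub>free_Abelian_group polytope_unions\<^esub> a"
    using assms(1) by (auto simp: polytope_group_def FactGroup_def RCOSETS_def)
  define d where "d = (SOME d. d \<in> Q)"
  have "d \<in> Q" unfolding d_def using assms(2) by (rule someI)
  then obtain g h where gh: "g \<in> polytope_relation_subgroup" "h \<in> polytope_relation_subgroup"
    "c = g + a" "d = h + a"
    using assms(2) by (auto simp: Q r_coset_def)
  show ?thesis
    using AE_frag_indicator_relation_subgroup[OF gh(1)] AE_frag_indicator_relation_subgroup[OF gh(2)]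
    unfolding polytope_group_indicator_def d_def[symmetric]
    by eventually_elim (simp add: gh(3,4) frag_indicator_add)
qed

lemma polytope_class_in_carrier:
  "A \<in> polytope_unions \<Longrightarrow> polytope_class A \<in> carrier polytope_group"
  by (auto simp: polytope_group_def polytope_class_def FactGroup_def RCOSETS_def)

lemma polytope_group_indicator_class:
  assumes "A \<in> polytope_unions"
  shows "AE x in lebesgue. polytope_group_indicator (polytope_class A) x = indicator A x"
proof -
  have "frag_of A \<in> polytope_class A"
    unfolding polytope_class_def
    by (rule group.rcos_self[OF group_free_Abelian_group _ polytope_relation_subgroup])
      (use assms in auto)
  from polytope_group_indicator_AE[OF polytope_class_in_carrier[OF assms] this]
  show ?thesis by (simp add: frag_indicator_of)
qed

lemma polytope_group_indicator_mult:
  assumes "Q \<in> carrier polytope_group" "R \<in> carrier polytope_group"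
  shows "AE x in lebesgue. polytope_group_indicator (Q \<otimes>\<^bsub>polytope_group\<^esub> R) x =
           polytope_group_indicator Q x + polytope_group_indicator R x"
proof -
  have ne: "\<exists>c. c \<in> Z" if "Z \<in> carrier polytope_group" for Z :: "((real^'n) set \<Rightarrow>\<^sub>0 int) set"
    using that subgroup.one_closed[OF polytope_relation_subgroup]
    by (auto simp: polytope_group_def FactGroup_def RCOSETS_def r_coset_def)
  obtain c d where cd: "c \<in> Q" "d \<in> R" using ne assms by blast
  have "c + d \<in> Q \<otimes>\<^bsub>polytope_group\<^esub> R"
    using cd by (auto simp: polytope_group_def FactGroup_def set_mult_def)
  moreover have "Q \<otimes>\<^bsub>polytope_group\<^esub> R \<in> carrier polytope_group"
    using assms comm_group_polytope_group
    by (meson comm_group.axioms(2) group.is_monoid monoid.m_closed)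
  ultimately have "AE x in lebesgue. polytope_group_indicator (Q \<otimes>\<^bsub>polytope_group\<^esub> R) x =
      frag_indicator (c + d) x" by (intro polytope_group_indicator_AE)
  with polytope_group_indicator_AE[OF assms(1) cd(1)] polytope_group_indicator_AE[OF assms(2) cd(2)]
  show ?thesis by eventually_elim (simp add: frag_indicator_add)
qed

(* For every x only finitely many terms of the sum are nonzero, since polytopes are bounded. *)
definition multi_tiles :: "((real^'n) set \<Rightarrow>\<^sub>0 int) set \<Rightarrow> bool" where
  "multi_tiles Q \<longleftrightarrow>
     (\<exists>k::int. AE x in lebesgue.
        (\<Sum>\<^sub>\<infinity>l\<in>integer_lattice. polytope_group_indicator Q (x - l)) = of_int k)"


section \<open>Solid angle sums\<close>

definition solid_angle :: "(real^'n) set \<Rightarrow> real^'n \<Rightarrow> real" where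
  "solid_angle P x =
     Lim (at_right 0) (\<lambda>\<epsilon>. measure lebesgue (ball x \<epsilon> \<inter> P) / measure lebesgue (ball x \<epsilon>))"

definition solid_angle_sum :: "(real^'n) set \<Rightarrow> real \<Rightarrow> real" where
  "solid_angle_sum P t = (\<Sum>\<^sub>\<infinity>x\<in>integer_lattice. solid_angle ((\<lambda>y. t *\<^sub>R y) ` P) x)"

end

theory Submission
  imports Defs
begin

text \<open>
  Let \<open>g = (\<Sum>\<gamma>. 1\<^bsub>\<gamma>P\<^esub>)\<close>, the sum being over the signed permutation matrices \<open>\<gamma>\<close>, and write
  \<open>b\<close> for their number and \<open>d\<close> for the dimension. Multi-tiling says that the periodization
  \<open>y \<mapsto> (\<Sum>l. g (l + y))\<close> over the integer lattice is almost everywhere equal to some \<open>k\<close>.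

  Dilation preserves this property: since the integer lattice is the disjoint union of \<open>t ^ d\<close> cosets
  of its \<open>t\<close>-fold multiple, the periodization of \<open>z \<mapsto> g (z / t)\<close> is almost everywhere equal to
  \<open>k t ^ d\<close> (\<open>AE_periodization_dilate\<close>). Integrating a constant periodization \<open>c\<close> of
  \<open>(\<Sum>i. 1\<^bsub>S i\<^esub>)\<close> over a bounded set \<open>D\<close> gives
  \<open>(\<Sum>i. \<Sum>l. vol ((l + D) \<inter> S i)) = c vol D\<close> (\<open>integral_periodization\<close>). This is used twice.

  For \<open>D\<close> the half-open unit cube and \<open>S \<gamma> = \<gamma>P\<close> the translates of \<open>D\<close> partition space, and hence
  \<open>b vol P = k\<close>. For \<open>D\<close> the ball of radius \<open>\<epsilon>\<close> about 0 and \<open>S \<gamma> = \<gamma>(tP)\<close>, all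
  the \<open>b\<close> inner sums agree, because \<open>\<gamma>\<close> preserves the lattice, volumes and balls. Therefore
  \<open>(\<Sum>l. vol (B(l, \<epsilon>) \<inter> tP)) / vol (B(0, \<epsilon>)) = k t ^ d / b = vol P t ^ d\<close> for every
  \<open>\<epsilon> > 0\<close>, and as \<open>\<epsilon>\<close> tends to 0 the left-hand side tends to the solid angle sum
  (\<open>lattice_ball_sum_tendsto\<close>). The limits that define the solid angles exist, since
  for a convex set the density in a ball about one of its points does not decrease when the ball
  shrinks, and about a point outside a closed set it is eventually 0.
\<close>

section \<open>The integer lattice and signed permutation matrices\<close>

lemma integer_lattice_uminus: "x \<in> integer_lattice \<Longrightarrow> - x \<in> integer_lattice"
  by (simp add: integer_lattice_def)

lemma countable_integer_lattice: "countable (integer_lattice :: (real^'n) set)"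
proof -
  have "integer_lattice = range (\<lambda>f :: 'n \<Rightarrow> int. \<chi> i. real_of_int (f i))"
  proof (intro equalityI subsetI)
    fix x :: "real^'n" assume "x \<in> integer_lattice"
    then have "x = (\<chi> i. of_int \<lfloor>x $ i\<rfloor>)"
      by (simp add: integer_lattice_def vec_eq_iff)
    then show "x \<in> range (\<lambda>f :: 'n \<Rightarrow> int. \<chi> i. real_of_int (f i))"
      by (intro image_eqI[of _ _ "\<lambda>i. \<lfloor>x $ i\<rfloor>"]) auto
  qed (auto simp: integer_lattice_def)
  then show ?thesis by (metis countable_image countableI_type)
qed

lemma bounded_difference_set:
  fixes S T :: "'a::real_normed_vector set"
  assumes "bounded S" "bounded T"
  shows "bounded {x - y |x y. x \<in> S \<and> y \<in> T}"
proof -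
  have "{x - y |x y. x \<in> S \<and> y \<in> T} = (\<lambda>(x, y). x - y) ` (S \<times> T)" by force
  then show ?thesis using bounded_minus[OF assms] by simp
qed

lemma finite_integer_lattice_bounded:
  fixes S :: "(real^'n) set"
  assumes "bounded S"
  shows "finite (integer_lattice \<inter> S)"
proof -
  obtain b where b: "\<And>x. x \<in> S \<Longrightarrow> norm x \<le> b" using assms by (auto simp: bounded_iff)
  define F where "F = (PiE (UNIV :: 'n set) (\<lambda>_. {- \<lceil>b\<rceil>..\<lceil>b\<rceil>}))"
  have "integer_lattice \<inter> S \<subseteq> (\<lambda>f. \<chi> i. real_of_int (f i)) ` F"
  proof
    fix x assume x: "x \<in> integer_lattice \<inter> S"
    have "\<lfloor>x $ i\<rfloor> \<in> {- \<lceil>b\<rceil>..\<lceil>b\<rceil>}" for i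
    proof -
      have "\<bar>x $ i\<bar> \<le> b" using b[of x] component_le_norm_cart[of x i] x by auto
      moreover have "x $ i = of_int \<lfloor>x $ i\<rfloor>" using x by (simp add: integer_lattice_def)
      ultimately show ?thesis by (auto; linarith)
    qed
    moreover have "x = (\<chi> i. of_int \<lfloor>x $ i\<rfloor>)"
      using x by (simp add: integer_lattice_def vec_eq_iff)
    ultimately show "x \<in> (\<lambda>f. \<chi> i. real_of_int (f i)) ` F"
      unfolding F_def by (intro image_eqI[of _ _ "\<lambda>i. \<lfloor>x $ i\<rfloor>"]) auto
  qed
  moreover have "finite F" unfolding F_def by (intro finite_PiE) auto
  ultimately show ?thesis by (meson finite_imageI finite_subset)
qed

lemma hyperoctahedral_action:
  fixes \<gamma> :: "real^'n^'n"
  assumes "\<gamma> \<in> hyperoctahedral"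
  obtains p s where "p permutes UNIV" "\<And>i. s i \<in> {-1, 1}" "\<And>v i. (\<gamma> *v v) $ i = s i * v $ p i"
proof -
  obtain p s where ps: "p permutes UNIV" "\<forall>i. s i \<in> {-1, 1}"
    "\<gamma> = (\<chi> i j. if j = p i then s i else 0)"
    using assms by (auto simp: hyperoctahedral_def)
  have "(\<gamma> *v v) $ i = s i * v $ p i" for v i
    by (simp add: ps(3) matrix_vector_mult_def if_distrib [of "\<lambda>z. z * _"] cong: if_cong)
  with ps(1,2) that show ?thesis by blast
qed

lemma orthogonal_transformation_hyperoctahedral:
  fixes \<gamma> :: "real^'n^'n"
  assumes "\<gamma> \<in> hyperoctahedral"
  shows "orthogonal_transformation ((*v) \<gamma>)"
proof -
  obtain p s where p: "p permutes UNIV" and s: "\<And>i. s i \<in> {-1, 1}"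
    and act: "\<And>v i. (\<gamma> *v v) $ i = s i * v $ p i"
    using hyperoctahedral_action[OF assms] by blast
  have "(\<gamma> *v v) \<bullet> (\<gamma> *v w) = v \<bullet> w" for v w
  proof -
    have "(s i * v $ p i) * (s i * w $ p i) = v $ p i * w $ p i" for i
      using s[of i] by auto
    then have "(\<gamma> *v v) \<bullet> (\<gamma> *v w) = (\<Sum>i\<in>UNIV. v $ p i * w $ p i)"
      unfolding inner_vec_def act inner_real_def by (rule sum.cong[OF refl])
    also have "\<dots> = v \<bullet> w"
      using sum.permute[OF p, of "\<lambda>i. v $ i * w $ i"] by (simp add: inner_vec_def o_def)
    finally show ?thesis .
  qed
  then show ?thesis by (simp add: orthogonal_transformation_def)
qed

lemma bij_betw_hyperoctahedral_lattice:
  fixes \<gamma> :: "real^'n^'n"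
  assumes "\<gamma> \<in> hyperoctahedral"
  shows "bij_betw ((*v) \<gamma>) integer_lattice integer_lattice"
proof -
  obtain p s where p: "p permutes UNIV" and s: "\<And>i. s i \<in> {-1, 1}"
    and act: "\<And>v i. (\<gamma> *v v) $ i = s i * v $ p i"
    using hyperoctahedral_action[OF assms] by blast
  have s_int: "s i \<in> \<int>" and s_sq: "s i * s i = 1" for i using s[of i] by auto
  have "\<exists>v\<in>integer_lattice. w = \<gamma> *v v" if "w \<in> integer_lattice" for w
  proof
    define v :: "real^'n" where "v = (\<chi> j. s (inv_into UNIV p j) * w $ (inv_into UNIV p j))"
    show "v \<in> integer_lattice" using that s_int by (simp add: v_def integer_lattice_def)
    show "w = \<gamma> *v v"
      by (simp add: vec_eq_iff act v_def permutes_inverses[OF p] s_sq flip: mult.assoc)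
  qed
  moreover have "\<gamma> *v v \<in> integer_lattice" if "v \<in> integer_lattice" for v
    using that s_int by (simp add: integer_lattice_def act)
  moreover have "inj ((*v) \<gamma>)"
    using orthogonal_transformation_hyperoctahedral[OF assms] orthogonal_transformation_inj by blast
  ultimately show ?thesis by (auto simp: bij_betw_def inj_on_def)
qed

lemma prod_Basis_cart: "(\<Prod>b\<in>Basis. (x :: real^'n) \<bullet> b) = (\<Prod>i\<in>UNIV. x $ i)"
proof -
  have "Basis = range (\<lambda>i :: 'n. axis i (1 :: real))" by (auto simp: Basis_vec_def)
  moreover have "inj (\<lambda>i :: 'n. axis i (1 :: real))" by (simp add: inj_on_def axis_eq_axis)
  ultimately show ?thesis
    by (intro prod.reindex_cong[of "\<lambda>i. axis i 1"]) (simp_all add: inner_axis)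
qed

text \<open>The preimage of a box under a signed permutation is again a box, with permuted side lengths,
  and Lebesgue measure is determined by its values on boxes.\<close>
lemma distr_lborel_hyperoctahedral:
  fixes \<gamma> :: "real^'n^'n"
  assumes "\<gamma> \<in> hyperoctahedral"
  shows "distr lborel borel ((*v) \<gamma>) = lborel"
proof (rule lborel_eqI[symmetric])
  obtain p s where p: "p permutes UNIV" and s: "\<And>i. s i \<in> {-1, 1}"
    and act: "\<And>v i. (\<gamma> *v v) $ i = s i * v $ p i"
    using hyperoctahedral_action[OF assms] by blast
  fix l u :: "real^'n" assume "\<And>b. b \<in> Basis \<Longrightarrow> l \<bullet> b \<le> u \<bullet> b"
  have lu: "l $ i \<le> u $ i" for i
    using \<open>\<And>b. b \<in> Basis \<Longrightarrow> l \<bullet> b \<le> u \<bullet> b\<close>[of "axis i 1"]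
    by (simp add: inner_axis axis_in_Basis_iff)
  \<comment> \<open>A sign change reflects the interval, which exchanges its endpoints.\<close>
  define l' u' :: "real^'n" where
    "l' = (\<chi> j. if s (inv_into UNIV p j) = 1 then l $ (inv_into UNIV p j) else - u $ (inv_into UNIV p j))" and
    "u' = (\<chi> j. if s (inv_into UNIV p j) = 1 then u $ (inv_into UNIV p j) else - l $ (inv_into UNIV p j))"
  have "(l $ i < s i * v $ p i \<and> s i * v $ p i < u $ i) \<longleftrightarrow> (l' $ p i < v $ p i \<and> v $ p i < u' $ p i)" for v i
    using s[of i] by (auto simp: l'_def u'_def permutes_inverses[OF p])
  then have "v \<in> (*v) \<gamma> -` box l u \<longleftrightarrow> (\<forall>i. l' $ p i < v $ p i \<and> v $ p i < u' $ p i)" for v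
    by (simp add: mem_box_cart act)
  moreover have "(\<forall>i. l' $ p i < v $ p i \<and> v $ p i < u' $ p i) \<longleftrightarrow> v \<in> box l' u'" for v
    unfolding mem_box_cart using permutes_surj[OF p] by (metis surjD)
  ultimately have "(*v) \<gamma> -` box l u = box l' u'" by blast
  moreover have "(*v) \<gamma> \<in> borel_measurable borel"
    by (intro borel_measurable_continuous_onI linear_continuous_on linear_conv_bounded_linear[THEN iffD1]) simp
  moreover have "l' $ j \<le> u' $ j" for j using lu by (simp add: l'_def u'_def)
  then have "l' \<bullet> b \<le> u' \<bullet> b" if "b \<in> Basis" for b
    using that by (auto simp: Basis_vec_def inner_axis)
  moreover have "(\<Prod>j\<in>UNIV. (u' - l') $ j) = (\<Prod>i\<in>UNIV. (u - l) $ i)"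
  proof -
    have "(\<Prod>j\<in>UNIV. (u' - l') $ j) = (\<Prod>j\<in>UNIV. (u - l) $ (inv_into UNIV p j))"
      by (rule prod.cong) (auto simp: l'_def u'_def)
    also have "\<dots> = (\<Prod>i\<in>UNIV. (u - l) $ i)"
      using prod.permute[OF permutes_inv[OF p], of "\<lambda>i. (u - l) $ i"] by (simp add: o_def)
    finally show ?thesis .
  qed
  ultimately show "emeasure (distr lborel borel ((*v) \<gamma>)) (box l u) = (\<Prod>b\<in>Basis. (u - l) \<bullet> b)"
    by (simp add: emeasure_distr emeasure_lborel_box prod_Basis_cart del: vector_minus_component)
qed simp

lemma measure_hyperoctahedral_image:
  fixes \<gamma> :: "real^'n^'n"
  assumes "\<gamma> \<in> hyperoctahedral" "S \<in> sets borel"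
  shows "measure lebesgue ((*v) \<gamma> ` S) = measure lebesgue S"
proof -
  note orth = orthogonal_transformation_hyperoctahedral[OF assms(1)]
  have lin: "(*v) M \<in> borel_measurable borel" for M :: "real^'n^'n"
    by (intro borel_measurable_continuous_onI linear_continuous_on linear_conv_bounded_linear[THEN iffD1]) simp
  have om: "transpose \<gamma> ** \<gamma> = mat 1" "\<gamma> ** transpose \<gamma> = mat 1"
    using orth by (auto simp: orthogonal_transformation_matrix orthogonal_matrix_def)
  have "(*v) \<gamma> ` S = (*v) (transpose \<gamma>) -` S"
  proof (intro equalityI subsetI)
    fix y assume "y \<in> (*v) (transpose \<gamma>) -` S"
    then show "y \<in> (*v) \<gamma> ` S"
      by (intro image_eqI[of _ _ "transpose \<gamma> *v y"])
        (simp_all add: matrix_vector_mul_assoc om del: transpose_matrix_vector)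
  qed (auto simp: matrix_vector_mul_assoc om simp del: transpose_matrix_vector)
  then have meas: "(*v) \<gamma> ` S \<in> sets borel" using measurable_sets_borel[OF lin assms(2)] by simp
  have "measure lborel ((*v) \<gamma> ` S) = measure (distr lborel borel ((*v) \<gamma>)) ((*v) \<gamma> ` S)"
    by (simp add: distr_lborel_hyperoctahedral assms(1))
  also have "\<dots> = measure lborel S"
    using lin meas orthogonal_transformation_inj[OF orth] by (simp add: measure_distr inj_vimage_image_eq)
  finally show ?thesis using meas assms(2) by simp
qed

lemma AE_lebesgue_affine:
  fixes c :: "'a::euclidean_space"
  assumes "AE x in lebesgue. Q x" "s \<noteq> 0"
  shows "AE y in lebesgue. Q (s *\<^sub>R (c + y))"
proof -
  obtain N where N: "{x. \<not> Q x} \<subseteq> N" "N \<in> null_sets lebesgue"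
    using assms(1) by (auto simp: eventually_ae_filter)
  let ?M = "(+) (- c) ` ((*\<^sub>R) (1 / s) ` N)"
  have "negligible ?M"
    using N(2) by (intro negligible_translation negligible_differentiable_image_negligible)
      (auto simp: negligible_iff_null_sets linear_scale_self intro!: linear_imp_differentiable_on)
  then have "AE y in lebesgue. y \<notin> ?M" by (intro AE_not_in) (simp add: negligible_iff_null_sets)
  then show ?thesis
  proof eventually_elim
    case (elim y)
    have "y = - c + (1 / s) *\<^sub>R (s *\<^sub>R (c + y))" using assms(2) by simp
    then have "s *\<^sub>R (c + y) \<notin> N" using elim by blast
    then show ?case using N(1) by blast
  qed
qed

section \<open>Periodization over the integer lattice\<close>

text \<open>The lattice points with all coordinates in \<open>[0, t)\<close>: one representative for each coset of the
  \<open>t\<close>-fold multiple of the lattice.\<close>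
definition lattice_residues :: "nat \<Rightarrow> (real^'n) set" where
  "lattice_residues t = {r \<in> integer_lattice. \<forall>i. 0 \<le> r $ i \<and> r $ i < real t}"

lemma card_lattice_residues: "card (lattice_residues t :: (real^'n) set) = t ^ CARD('n)"
proof -
  let ?f = "\<lambda>f :: 'n \<Rightarrow> nat. (\<chi> i. real (f i))"
  let ?F = "PiE (UNIV :: 'n set) (\<lambda>_. {..<t})"
  have "lattice_residues t = ?f ` ?F"
  proof (intro equalityI subsetI)
    fix r :: "real^'n" assume r: "r \<in> lattice_residues t"
    have *: "r $ i = real (nat \<lfloor>r $ i\<rfloor>)" for i
      using r by (simp add: lattice_residues_def integer_lattice_def)
    have "nat \<lfloor>r $ i\<rfloor> < t" for i
    proof -
      have "r $ i < real t" using r by (simp add: lattice_residues_def)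
      then show ?thesis by (subst (asm) *) simp
    qed
    moreover have "r = ?f (\<lambda>i. nat \<lfloor>r $ i\<rfloor>)" unfolding vec_eq_iff using * by simp
    ultimately show "r \<in> ?f ` ?F" by (intro image_eqI) auto
  qed (auto simp: lattice_residues_def integer_lattice_def PiE_iff)
  moreover have "inj_on ?f ?F" by (auto simp: inj_on_def vec_eq_iff)
  ultimately show ?thesis by (simp add: card_image card_PiE)
qed

lemma finite_lattice_residues: "t > 0 \<Longrightarrow> finite (lattice_residues t :: (real^'n) set)"
  by (rule card_ge_0_finite) (simp add: card_lattice_residues)

lemma bij_betw_lattice_residues:
  assumes "t > 0"
  shows "bij_betw (\<lambda>(r, m). r + real t *\<^sub>R m) (lattice_residues t \<times> integer_lattice)
           (integer_lattice :: (real^'n) set)"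
proof (rule bij_betw_byWitness)
  \<comment> \<open>The inverse map divides each coordinate by \<open>t\<close> with remainder.\<close>
  define q :: "real^'n \<Rightarrow> real^'n" where "q l = (\<chi> i. of_int \<lfloor>l $ i / real t\<rfloor>)" for l
  let ?w = "\<lambda>l. (l - real t *\<^sub>R q l, q l)"
  have q: "q (r + real t *\<^sub>R m) = m" if "r \<in> lattice_residues t" "m \<in> integer_lattice" for r m
  proof -
    have "\<lfloor>(r $ i + real t * m $ i) / real t\<rfloor> = \<lfloor>m $ i\<rfloor>" for i
    proof -
      have "(r $ i + real t * m $ i) / real t = r $ i / real t + of_int \<lfloor>m $ i\<rfloor>"
        using assms that(2) by (simp add: field_simps integer_lattice_def)
      moreover have "\<lfloor>r $ i / real t\<rfloor> = 0"
        using assms that(1) by (simp add: lattice_residues_def floor_eq_iff)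
      ultimately show ?thesis by simp
    qed
    then show ?thesis using that(2) by (simp add: q_def vec_eq_iff integer_lattice_def)
  qed
  show "\<forall>a\<in>lattice_residues t \<times> integer_lattice. ?w (case a of (r, m) \<Rightarrow> r + real t *\<^sub>R m) = a"
    using q by auto
  show "\<forall>l\<in>integer_lattice. (case ?w l of (r, m) \<Rightarrow> r + real t *\<^sub>R m) = l" by simp
  show "(\<lambda>(r, m). r + real t *\<^sub>R m) ` (lattice_residues t \<times> integer_lattice) \<subseteq> integer_lattice"
    by (auto simp: lattice_residues_def integer_lattice_def)
  have "0 \<le> x - real t * of_int \<lfloor>x / real t\<rfloor>" "x - real t * of_int \<lfloor>x / real t\<rfloor> < real t" for x
  proof -
    have "of_int \<lfloor>x / real t\<rfloor> \<le> x / real t" "x / real t < of_int \<lfloor>x / real t\<rfloor> + 1"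
      by linarith+
    then have "real t * of_int \<lfloor>x / real t\<rfloor> \<le> real t * (x / real t)"
      "real t * (x / real t) < real t * (of_int \<lfloor>x / real t\<rfloor> + 1)"
      using assms by (simp_all only: mult_le_cancel_left_pos mult_less_cancel_left_pos of_nat_0_less_iff)
    moreover have "real t * (x / real t) = x" using assms by simp
    ultimately show "0 \<le> x - real t * of_int \<lfloor>x / real t\<rfloor>" "x - real t * of_int \<lfloor>x / real t\<rfloor> < real t"
      unfolding distrib_left by linarith+
  qed
  then show "?w ` integer_lattice \<subseteq> lattice_residues t \<times> integer_lattice"
    by (auto simp: lattice_residues_def integer_lattice_def q_def)
qed

text \<open>Writing a lattice point as \<open>r + t m\<close> with a residue \<open>r\<close>, the sum splits into \<open>t ^ d\<close>
  periodizations of \<open>g\<close>, evaluated at the points \<open>(r + y) / t\<close>.\<close>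
lemma AE_periodization_dilate:
  fixes g :: "real^'n \<Rightarrow> real"
  assumes supp: "bounded {z. g z \<noteq> 0}" and t: "t > 0"
    and AE: "AE y in lebesgue. (\<Sum>\<^sub>\<infinity>l\<in>integer_lattice. g (l + y)) = c"
  shows "AE y in lebesgue. (\<Sum>\<^sub>\<infinity>l\<in>integer_lattice. g ((1 / real t) *\<^sub>R (l + y))) = c * real t ^ CARD('n)"
proof -
  let ?R = "lattice_residues t :: (real^'n) set"
  have "AE y in lebesgue. \<forall>r\<in>?R. (\<Sum>\<^sub>\<infinity>m\<in>integer_lattice. g (m + (1 / real t) *\<^sub>R (r + y))) = c"
    by (intro AE_ball_countable' AE_lebesgue_affine[OF AE] countable_finite finite_lattice_residues t)
      (use t in auto)
  then show ?thesis
  proof eventually_elim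
    case (elim y)
    define h where "h = (\<lambda>l. g ((1 / real t) *\<^sub>R (l + y)))"
    have h: "h (r + real t *\<^sub>R m) = g (m + (1 / real t) *\<^sub>R (r + y))" for r m
      unfolding h_def using t by (simp add: algebra_simps)
    have "{l. h l \<noteq> 0} \<subseteq> (\<lambda>z. real t *\<^sub>R z - y) ` {z. g z \<noteq> 0}"
    proof
      fix l assume "l \<in> {l. h l \<noteq> 0}"
      moreover have "l = real t *\<^sub>R ((1 / real t) *\<^sub>R (l + y)) - y" using t by simp
      ultimately show "l \<in> (\<lambda>z. real t *\<^sub>R z - y) ` {z. g z \<noteq> 0}"
        unfolding h_def by blast
    qed
    moreover have "bounded ((\<lambda>z. z - y) ` (*\<^sub>R) (real t) ` {z. g z \<noteq> 0})"
      by (intro bounded_translation_minus bounded_scaling supp)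
    ultimately have "bounded {l. h l \<noteq> 0}" by (simp add: image_image bounded_subset)
    from finite_integer_lattice_bounded[OF this] have "h summable_on integer_lattice"
      by (intro finite_nonzero_values_imp_summable_on) (simp add: Int_def)
    then have sm: "(\<lambda>p. h (case p of (r, m) \<Rightarrow> r + real t *\<^sub>R m)) summable_on ?R \<times> integer_lattice"
      using summable_on_reindex_bij_betw[OF bij_betw_lattice_residues[OF t], of h] by simp
    have "infsum h integer_lattice
        = (\<Sum>\<^sub>\<infinity>p\<in>?R \<times> integer_lattice. h (case p of (r, m) \<Rightarrow> r + real t *\<^sub>R m))"
      using infsum_reindex_bij_betw[OF bij_betw_lattice_residues[OF t], of h] by simp
    also have "\<dots> = (\<Sum>\<^sub>\<infinity>r\<in>?R. \<Sum>\<^sub>\<infinity>m\<in>integer_lattice. h (r + real t *\<^sub>R m))"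
      using infsum_Sigma_banach[OF sm] by simp
    also have "\<dots> = (\<Sum>r\<in>?R. c)"
      using finite_lattice_residues[OF t, where ?'n = 'n] elim by (simp add: h)
    also have "\<dots> = c * real t ^ CARD('n)" by (simp add: card_lattice_residues)
    finally show ?case by (simp add: h_def)
  qed
qed

text \<open>The integral over \<open>D\<close> of a constant periodization, computed term by term. As all sets are
  bounded, only a finite set \<open>K\<close> of lattice translates is involved.\<close>
lemma integral_periodization:
  fixes S :: "'i \<Rightarrow> (real^'n) set"
  assumes I: "finite I" and S: "\<And>i. i \<in> I \<Longrightarrow> S i \<in> lmeasurable" "\<And>i. i \<in> I \<Longrightarrow> bounded (S i)"
    and D: "D \<in> lmeasurable" "bounded D"
    and AE: "AE y in lebesgue. (\<Sum>\<^sub>\<infinity>l\<in>integer_lattice. \<Sum>i\<in>I. indicator (S i) (l + y)) = c"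
  shows "(\<Sum>i\<in>I. \<Sum>\<^sub>\<infinity>l\<in>integer_lattice. measure lebesgue ((+) l ` D \<inter> S i)) = c * measure lebesgue D"
proof -
  define K where "K = integer_lattice \<inter> (\<Union>i\<in>I. {x - y |x y. x \<in> S i \<and> y \<in> D})"
  have "finite K" unfolding K_def
    by (intro finite_integer_lattice_bounded bounded_UN I ballI bounded_difference_set S(2) D(2))
  have K: "K \<subseteq> integer_lattice" by (simp add: K_def)
  have out: "l + y \<notin> S i" if "l \<in> integer_lattice" "l \<notin> K" "i \<in> I" "y \<in> D" for l y i
  proof
    assume "l + y \<in> S i"
    moreover have "l = (l + y) - y" by simp
    ultimately show False using that unfolding K_def by blast
  qed
  have trans: "measure lebesgue ((+) l ` D \<inter> S i)
      = (\<integral>y. indicator D y * indicator (S i) (l + y) \<partial>lebesgue)" (is ?M)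
    "integrable lebesgue (\<lambda>y. indicator D y * indicator (S i) (l + y) :: real)" (is ?I)
    if "i \<in> I" for l i
  proof -
    have eq: "(+) l ` D \<inter> S i = (+) l ` (D \<inter> (+) (- l) ` S i)" by force
    have meas: "D \<inter> (+) (- l) ` S i \<in> lmeasurable"
      using measurable_translation[OF S(1)[OF that]] D(1)
      by (intro fmeasurable_Int_fmeasurable fmeasurableD)
    have ind: "indicator D y * indicator (S i) (l + y) = (indicator (D \<inter> (+) (- l) ` S i) y :: real)" for y
      by (force simp: indicator_def image_iff)
    show ?M unfolding eq measure_translation ind using meas by (simp add: fmeasurableD)
    show ?I unfolding ind using meas by (intro integrable_real_indicator) (auto simp: fmeasurable_def)
  qed
  have "(\<Sum>i\<in>I. \<Sum>\<^sub>\<infinity>l\<in>integer_lattice. measure lebesgue ((+) l ` D \<inter> S i))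
      = (\<Sum>i\<in>I. \<Sum>l\<in>K. measure lebesgue ((+) l ` D \<inter> S i))"
  proof (rule sum.cong[OF refl])
    fix i assume "i \<in> I"
    have "(+) l ` D \<inter> S i = {}" if "l \<in> integer_lattice - K" for l
      using out[of l i] \<open>i \<in> I\<close> that by auto
    then have "(\<Sum>\<^sub>\<infinity>l\<in>integer_lattice. measure lebesgue ((+) l ` D \<inter> S i))
        = (\<Sum>\<^sub>\<infinity>l\<in>K. measure lebesgue ((+) l ` D \<inter> S i))"
      using K by (intro infsum_cong_neutral) auto
    then show "(\<Sum>\<^sub>\<infinity>l\<in>integer_lattice. measure lebesgue ((+) l ` D \<inter> S i))
        = (\<Sum>l\<in>K. measure lebesgue ((+) l ` D \<inter> S i))" using \<open>finite K\<close> by simp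
  qed
  also have "\<dots> = (\<integral>y. (\<Sum>i\<in>I. \<Sum>l\<in>K. indicator D y * indicator (S i) (l + y)) \<partial>lebesgue)"
    by (simp add: trans Bochner_Integration.integral_sum Bochner_Integration.integrable_sum)
  also have "\<dots> = (\<integral>y. c * indicator D y \<partial>lebesgue)"
  proof (rule integral_cong_AE)
    show "AE y in lebesgue. (\<Sum>i\<in>I. \<Sum>l\<in>K. indicator D y * indicator (S i) (l + y)) = c * indicator D y"
      using AE
    proof eventually_elim
      case (elim y)
      show ?case
      proof (cases "y \<in> D")
        case True
        have "c = (\<Sum>\<^sub>\<infinity>l\<in>K. \<Sum>i\<in>I. indicator (S i) (l + y))"
          unfolding elim[symmetric] using K True out by (intro infsum_cong_neutral) (auto intro!: sum.neutral)
        also have "\<dots> = (\<Sum>i\<in>I. \<Sum>l\<in>K. indicator (S i) (l + y))"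
          unfolding infsum_finite[OF \<open>finite K\<close>] by (rule sum.swap)
        finally show ?thesis using True by simp
      qed simp
    qed
  qed (use trans(2) D in \<open>auto intro!: borel_measurable_sum dest: borel_measurable_integrable\<close>)
  also have "\<dots> = c * measure lebesgue D" using D(1) by (simp add: fmeasurableD)
  finally show ?thesis .
qed

lemma unit_cube:
  defines "C \<equiv> {y :: real^'n. \<forall>i. 0 \<le> y $ i \<and> y $ i < 1}"
  shows "C \<in> lmeasurable" "bounded C" "measure lebesgue C = 1"
proof -
  have sub: "C \<subseteq> cbox 0 1" "box 0 1 \<subseteq> C" by (auto simp: C_def mem_box_cart less_imp_le)
  show b: "bounded C" using sub(1) bounded_cbox bounded_subset by blast
  have "convex C"
  proof -
    have "C = (\<Inter>i. {y. 0 \<le> y $ i} \<inter> {y. y $ i < 1})" by (auto simp: C_def)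
    moreover have "convex {y :: real^'n. 0 \<le> y $ i}" "convex {y :: real^'n. y $ i < 1}" for i
      using convex_halfspace_ge[of 0 "axis i 1 :: real^'n"] convex_halfspace_lt[of "axis i 1 :: real^'n" 1]
      by (simp_all add: inner_axis' )
    ultimately show ?thesis by (auto intro!: convex_INT convex_Int)
  qed
  then show m: "C \<in> lmeasurable" using b by (rule measurable_convex)
  have "measure lebesgue C \<le> measure lebesgue (cbox 0 1 :: (real^'n) set)"
    by (rule measure_mono_fmeasurable[OF sub(1) fmeasurableD[OF m] lmeasurable_cbox])
  moreover have "measure lebesgue (box 0 1 :: (real^'n) set) \<le> measure lebesgue C"
    by (rule measure_mono_fmeasurable[OF sub(2) fmeasurableD[OF lmeasurable_box] m])
  moreover have "measure lebesgue (cbox 0 1 :: (real^'n) set) = 1" "measure lebesgue (box 0 1 :: (real^'n) set) = 1"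
    using content_cbox_cart[of "0::real^'n" 1]
    by (simp_all add: interval_eq_empty_cart measure_lborel_box_eq measure_lborel_cbox_eq)
  ultimately show "measure lebesgue C = 1" by simp
qed

text \<open>A point \<open>x\<close> lies in the translate of the half-open unit cube by the lattice point of
  the rounded-down coordinates of \<open>x\<close> and in no other one.\<close>
lemma sum_measure_unit_cubes:
  fixes S :: "(real^'n) set"
  assumes "S \<in> lmeasurable" "bounded S"
  defines "C \<equiv> {y :: real^'n. \<forall>i. 0 \<le> y $ i \<and> y $ i < 1}"
  shows "(\<Sum>\<^sub>\<infinity>l\<in>integer_lattice. measure lebesgue ((+) l ` C \<inter> S)) = measure lebesgue S"
proof -
  note C = unit_cube[where 'n = 'n, folded C_def]
  let ?fl = "\<lambda>x :: real^'n. \<chi> i. real_of_int \<lfloor>x $ i\<rfloor>"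
  have mem: "x \<in> (+) l ` C \<longleftrightarrow> l = ?fl x" if "l \<in> integer_lattice" for x l
  proof -
    have "x \<in> (+) l ` C \<longleftrightarrow> x - l \<in> C"
      by (auto simp: image_iff intro!: bexI[of _ "x - l"])
    also have "\<dots> \<longleftrightarrow> (\<forall>i. l $ i \<le> x $ i \<and> x $ i < l $ i + 1)" by (auto simp: C_def algebra_simps)
    also have "\<dots> \<longleftrightarrow> (\<forall>i. l $ i = real_of_int \<lfloor>x $ i\<rfloor>)"
    proof (intro all_cong1)
      fix i
      have "l $ i \<in> \<int>" using that by (simp add: integer_lattice_def)
      then obtain k where "l $ i = of_int k" by (rule Ints_cases)
      then show "(l $ i \<le> x $ i \<and> x $ i < l $ i + 1) = (l $ i = real_of_int \<lfloor>x $ i\<rfloor>)"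
        using floor_eq_iff[of "x $ i" k] by auto
    qed
    finally show ?thesis by (simp add: vec_eq_iff)
  qed
  define K where "K = integer_lattice \<inter> {x - y |x y. x \<in> S \<and> y \<in> C}"
  have "finite K" unfolding K_def
    by (intro finite_integer_lattice_bounded bounded_difference_set assms C)
  have K: "K \<subseteq> integer_lattice" by (simp add: K_def)
  have fm: "(+) l ` C \<inter> S \<in> lmeasurable" for l
    by (intro fmeasurable_Int_fmeasurable measurable_translation C(1) fmeasurableD assms(1))
  have disj: "pairwise (\<lambda>l m. disjnt ((+) l ` C \<inter> S) ((+) m ` C \<inter> S)) K"
  proof (rule pairwiseI)
    fix l m assume lm: "l \<in> K" "m \<in> K" "l \<noteq> m"
    then have L: "l \<in> integer_lattice" "m \<in> integer_lattice" using K by auto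
    have "\<not> (x \<in> (+) l ` C \<and> x \<in> (+) m ` C)" for x
      unfolding mem[OF L(1)] mem[OF L(2)] using lm(3) by metis
    then show "disjnt ((+) l ` C \<inter> S) ((+) m ` C \<inter> S)" unfolding disjnt_iff by blast
  qed
  have "(+) l ` C \<inter> S = {}" if "l \<in> integer_lattice - K" for l
  proof (rule ccontr)
    assume "(+) l ` C \<inter> S \<noteq> {}"
    then obtain y where "l + y \<in> S" "y \<in> C" by blast
    moreover have "l = (l + y) - y" by simp
    ultimately show False using that unfolding K_def by blast
  qed
  then have "(\<Sum>\<^sub>\<infinity>l\<in>integer_lattice. measure lebesgue ((+) l ` C \<inter> S))
      = (\<Sum>\<^sub>\<infinity>l\<in>K. measure lebesgue ((+) l ` C \<inter> S))"
    using K by (intro infsum_cong_neutral) auto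
  also have "\<dots> = (\<Sum>l\<in>K. measure lebesgue ((+) l ` C \<inter> S))" using \<open>finite K\<close> by simp
  also have "\<dots> = measure lebesgue (\<Union>l\<in>K. (+) l ` C \<inter> S)"
    by (rule measure_UNION'[OF \<open>finite K\<close> fm disj, symmetric])
  also have "(\<Union>l\<in>K. (+) l ` C \<inter> S) = S"
  proof -
    have "\<exists>l\<in>K. x \<in> (+) l ` C" if "x \<in> S" for x
    proof
      have fl: "?fl x \<in> integer_lattice" by (simp add: integer_lattice_def)
      show x: "x \<in> (+) (?fl x) ` C" by (rule mem[OF fl, THEN iffD2, OF refl])
      then obtain y where y: "x = ?fl x + y" "y \<in> C" by (rule imageE)
      from y(1)[symmetric] have "?fl x = x - y" by (rule eq_diff_eq[THEN iffD2])
      with y(2) show "?fl x \<in> K" unfolding K_def using fl that by blast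
    qed
    then show ?thesis by blast
  qed
  finally show ?thesis .
qed

section \<open>Solid angles of convex bodies\<close>

text \<open>The homothety with centre \<open>x\<close> and ratio \<open>a / b\<close> maps \<open>S\<close> into itself and the ball of
  radius \<open>b\<close> onto the ball of radius \<open>a\<close>.\<close>
lemma ball_density_antimono:
  fixes S :: "'a::euclidean_space set"
  assumes "convex S" "S \<in> lmeasurable" "x \<in> S" "0 < a" "a \<le> b"
  shows "measure lebesgue (ball x b \<inter> S) / measure lebesgue (ball x b)
       \<le> measure lebesgue (ball x a \<inter> S) / measure lebesgue (ball x a)"
proof -
  define u where "u = a / b"
  have u: "0 < u" "u \<le> 1" "a = u * b" "b > 0" using assms by (auto simp: u_def)
  let ?T = "\<lambda>y. u *\<^sub>R y + (1 - u) *\<^sub>R x"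
  have sub: "?T ` (ball x b \<inter> S) \<subseteq> ball x a \<inter> S"
  proof (clarify, intro IntI)
    fix y assume y: "y \<in> ball x b" "y \<in> S"
    have "x - ?T y = u *\<^sub>R (x - y)" by (simp add: algebra_simps)
    then have "dist x (?T y) = u * dist x y" using u by (simp add: dist_norm)
    then show "?T y \<in> ball x a" using y(1) u by simp
    show "?T y \<in> S" using convexD[OF assms(1) y(2) assms(3), of u "1 - u"] u by simp
  qed
  have fm: "ball x r \<inter> S \<in> lmeasurable" for r
    using assms(2) by (intro fmeasurable_Int_fmeasurable) (auto simp: fmeasurableD)
  have "?T ` (ball x b \<inter> S) \<in> lmeasurable"
  proof (rule measurable_convex)
    have "convex ((\<lambda>y. (1 - u) *\<^sub>R x + u *\<^sub>R y) ` (ball x b \<inter> S))"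
      using assms(1) by (intro convex_affinity convex_Int) auto
    then show "convex (?T ` (ball x b \<inter> S))" by (simp add: add.commute)
    show "bounded (?T ` (ball x b \<inter> S))" using sub bounded_ball bounded_subset by blast
  qed
  then have "measure lebesgue (?T ` (ball x b \<inter> S)) \<le> measure lebesgue (ball x a \<inter> S)"
    using sub fm by (intro measure_mono_fmeasurable fmeasurableD)
  moreover have "measure lebesgue (?T ` (ball x b \<inter> S)) = u ^ DIM('a) * measure lebesgue (ball x b \<inter> S)"
    using measure_lebesgue_affine[of u "(1 - u) *\<^sub>R x" "ball x b \<inter> S"] u by simp
  ultimately have le: "u ^ DIM('a) * measure lebesgue (ball x b \<inter> S) \<le> measure lebesgue (ball x a \<inter> S)"
    by simp
  have vol: "measure lebesgue (ball x a) = u ^ DIM('a) * measure lebesgue (ball x b)"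
    using u by (simp add: content_ball power_mult_distrib)
  have "measure lebesgue (ball x b \<inter> S) / measure lebesgue (ball x b)
      = u ^ DIM('a) * measure lebesgue (ball x b \<inter> S) / measure lebesgue (ball x a)"
    unfolding vol using u(1) by (intro mult_divide_mult_cancel_left[symmetric]) simp
  also have "\<dots> \<le> measure lebesgue (ball x a \<inter> S) / measure lebesgue (ball x a)"
    by (rule divide_right_mono[OF le measure_nonneg])
  finally show ?thesis .
qed

text \<open>The constant \<open>solid_angle\<close> is defined by \<open>Lim\<close>, which carries no information unless the
  limit exists.\<close>
lemma solid_angle_tendsto:
  fixes S :: "(real^'n) set"
  assumes "convex S" "compact S"
  shows "((\<lambda>\<epsilon>. measure lebesgue (ball x \<epsilon> \<inter> S) / measure lebesgue (ball x \<epsilon>)) \<longlongrightarrow> solid_angle S x)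
           (at_right 0)"
proof -
  let ?r = "\<lambda>\<epsilon>. measure lebesgue (ball x \<epsilon> \<inter> S) / measure lebesgue (ball x \<epsilon>)"
  have S: "S \<in> lmeasurable" using assms by (simp add: lmeasurable_compact)
  have "\<exists>l. (?r \<longlongrightarrow> l) (at_right 0)"
  proof (cases "x \<in> S")
    case True
    note mono = ball_density_antimono[OF assms(1) S True]
    have le1: "?r e \<le> 1" for e
    proof -
      have "measure lebesgue (ball x e \<inter> S) \<le> measure lebesgue (ball x e)"
        using S by (intro measure_mono_fmeasurable) (auto simp: fmeasurableD)
      from divide_right_mono[OF this measure_nonneg]
      show ?thesis by (rule order_trans) (simp only: divide_self_if split: if_split, simp)
    qed
    have bdd: "bdd_above (?r ` {0<..})" using le1 by (intro bdd_aboveI[of _ 1]) blast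
    have "(?r \<longlongrightarrow> (SUP e\<in>{0<..}. ?r e)) (at_right 0)"
    proof (rule increasing_tendsto)
      show "\<forall>\<^sub>F e in at_right 0. ?r e \<le> (SUP e\<in>{0<..}. ?r e)"
        by (intro eventually_mono[OF eventually_at_right_less] cSUP_upper[OF _ bdd]) simp
    next
      fix c assume "c < (SUP e\<in>{0<..}. ?r e)"
      then obtain e where e: "e > 0" "c < ?r e"
        using less_cSUP_iff[OF _ bdd, of c] by auto
      have "\<forall>\<^sub>F d in at_right 0. d \<in> {0<..<e}" by (rule eventually_at_right_real[OF e(1)])
      then show "\<forall>\<^sub>F d in at_right 0. c < ?r d"
      proof eventually_elim
        case (elim d)
        then show ?case using mono[of d e] e(2) by (auto intro: less_le_trans)
      qed
    qed
    then show ?thesis by blast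
  next
    case False
    then obtain e where e: "e > 0" "ball x e \<inter> S = {}"
      using assms(2)[THEN compact_imp_closed] open_contains_ball[of "- S"]
      by (auto simp: closed_def disjoint_eq_subset_Compl)
    have "\<forall>\<^sub>F d in at_right 0. d \<in> {0<..<e}" by (rule eventually_at_right_real[OF e(1)])
    then have "\<forall>\<^sub>F d in at_right 0. ?r d = 0"
    proof eventually_elim
      case (elim d)
      then have "ball x d \<subseteq> ball x e" by (intro subset_ball) simp
      then have "ball x d \<inter> S = {}" using e(2) by blast
      then show ?case by simp
    qed
    then show ?thesis by (intro exI[of _ 0] tendsto_eventually)
  qed
  then obtain l where l: "(?r \<longlongrightarrow> l) (at_right 0)" by blast
  then have "solid_angle S x = l"
    unfolding solid_angle_def by (intro tendsto_Lim) simp_all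
  with l show ?thesis by simp
qed

text \<open>For radii less than 1 only the finitely many lattice points at distance less than 1 from \<open>S\<close>
  contribute, so that limit and sum may be interchanged.\<close>
lemma lattice_ball_sum_tendsto:
  fixes S :: "(real^'n) set"
  assumes "convex S" "compact S"
  shows "((\<lambda>\<epsilon>. (\<Sum>\<^sub>\<infinity>l\<in>integer_lattice. measure lebesgue (ball l \<epsilon> \<inter> S)) / measure lebesgue (ball (0::real^'n) \<epsilon>))
           \<longlongrightarrow> (\<Sum>\<^sub>\<infinity>l\<in>integer_lattice. solid_angle S l)) (at_right 0)"
proof -
  define K where "K = integer_lattice \<inter> {x - y |x y. x \<in> S \<and> y \<in> ball 0 1}"
  have "finite K" unfolding K_def
    by (intro finite_integer_lattice_bounded bounded_difference_set compact_imp_bounded[OF assms(2)] bounded_ball)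
  have K: "K \<subseteq> integer_lattice" by (simp add: K_def)
  have out: "ball l e \<inter> S = {}" if "l \<in> integer_lattice - K" "e \<le> 1" for l e
  proof (rule ccontr)
    assume "ball l e \<inter> S \<noteq> {}"
    then obtain x where x: "x \<in> S" "dist l x < e" by auto
    have "l = x - (x - l)" "x - l \<in> ball 0 1" using x(2) that(2) by (auto simp: dist_norm norm_minus_commute)
    then show False using that(1) x(1) unfolding K_def by blast
  qed
  have lim: "((\<lambda>\<epsilon>. measure lebesgue (ball l \<epsilon> \<inter> S) / measure lebesgue (ball (0::real^'n) \<epsilon>))
      \<longlongrightarrow> solid_angle S l) (at_right 0)" for l
  proof (rule Lim_transform_eventually[OF solid_angle_tendsto[OF assms]])
    show "\<forall>\<^sub>F e in at_right 0. measure lebesgue (ball l e \<inter> S) / measure lebesgue (ball l e)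
        = measure lebesgue (ball l e \<inter> S) / measure lebesgue (ball (0::real^'n) e)"
      using eventually_at_right_less by eventually_elim (simp add: content_ball)
  qed
  have small: "\<forall>\<^sub>F e in at_right 0. e \<in> {0<..<1::real}" by (rule eventually_at_right_real) simp
  have zero: "solid_angle S l = 0" if "l \<in> integer_lattice - K" for l
  proof (rule tendsto_unique[OF _ lim])
    have "\<forall>\<^sub>F e in at_right 0. measure lebesgue (ball l e \<inter> S) / measure lebesgue (ball (0::real^'n) e) = 0"
      using small by eventually_elim (simp add: out[OF that])
    then show "((\<lambda>e. measure lebesgue (ball l e \<inter> S) / measure lebesgue (ball (0::real^'n) e))
        \<longlongrightarrow> 0) (at_right 0)" by (rule tendsto_eventually)
  qed simp
  have "(\<Sum>\<^sub>\<infinity>l\<in>integer_lattice. solid_angle S l) = (\<Sum>\<^sub>\<infinity>l\<in>K. solid_angle S l)"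
    using K zero by (intro infsum_cong_neutral) auto
  then have 1: "(\<Sum>\<^sub>\<infinity>l\<in>integer_lattice. solid_angle S l) = (\<Sum>l\<in>K. solid_angle S l)"
    using \<open>finite K\<close> by simp
  show ?thesis unfolding 1
  proof (rule Lim_transform_eventually[OF tendsto_sum[OF lim]])
    show "\<forall>\<^sub>F e in at_right 0. (\<Sum>l\<in>K. measure lebesgue (ball l e \<inter> S) / measure lebesgue (ball (0::real^'n) e))
        = (\<Sum>\<^sub>\<infinity>l\<in>integer_lattice. measure lebesgue (ball l e \<inter> S)) / measure lebesgue (ball (0::real^'n) e)"
      using small
    proof eventually_elim
      case (elim e)
      have "(\<Sum>\<^sub>\<infinity>l\<in>integer_lattice. measure lebesgue (ball l e \<inter> S)) = (\<Sum>\<^sub>\<infinity>l\<in>K. measure lebesgue (ball l e \<inter> S))"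
        using K elim out by (intro infsum_cong_neutral) auto
      then show ?case using \<open>finite K\<close> by (simp add: sum_divide_distrib)
    qed
  qed
qed

section \<open>Multi-tiling and the symmetrized polytope\<close>

lemma polytope_group_indicator_finprod:
  fixes A :: "'i \<Rightarrow> (real^'n) set"
  assumes "finite I" "\<And>i. i \<in> I \<Longrightarrow> A i \<in> polytope_unions"
  shows "AE x in lebesgue. polytope_group_indicator (\<Otimes>\<^bsub>polytope_group\<^esub>i\<in>I. polytope_class (A i)) x
           = (\<Sum>i\<in>I. indicator (A i) x)"
  using assms
proof (induction I rule: finite_induct)
  case empty
  interpret comm_group "polytope_group :: ((real^'n) set \<Rightarrow>\<^sub>0 int) set monoid"
    by (rule comm_group_polytope_group)
  have "(0 :: (real^'n) set \<Rightarrow>\<^sub>0 int) \<in> \<one>\<^bsub>polytope_group\<^esub>"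
    using subgroup.one_closed[OF polytope_relation_subgroup] by (simp add: polytope_group_def)
  from polytope_group_indicator_AE[OF one_closed this] show ?case by (simp add: frag_indicator_def)
next
  case (insert i I)
  interpret comm_group "polytope_group :: ((real^'n) set \<Rightarrow>\<^sub>0 int) set monoid"
    by (rule comm_group_polytope_group)
  have mem: "polytope_class (A j) \<in> carrier polytope_group" if "j \<in> insert i I" for j
    using insert.prems that by (intro polytope_class_in_carrier) auto
  have "(\<Otimes>\<^bsub>polytope_group\<^esub>j\<in>insert i I. polytope_class (A j))
      = polytope_class (A i) \<otimes>\<^bsub>polytope_group\<^esub> (\<Otimes>\<^bsub>polytope_group\<^esub>j\<in>I. polytope_class (A j))"
    using insert.hyps mem by (intro finprod_insert) auto
  moreover have "(\<Otimes>\<^bsub>polytope_group\<^esub>j\<in>I. polytope_class (A j)) \<in> carrier polytope_group"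
    using mem by (intro finprod_closed) auto
  ultimately have split: "AE x in lebesgue.
      polytope_group_indicator (\<Otimes>\<^bsub>polytope_group\<^esub>j\<in>insert i I. polytope_class (A j)) x
        = polytope_group_indicator (polytope_class (A i)) x
          + polytope_group_indicator (\<Otimes>\<^bsub>polytope_group\<^esub>j\<in>I. polytope_class (A j)) x"
    using polytope_group_indicator_mult[OF mem[of i]] by simp
  have IH: "AE x in lebesgue.
      polytope_group_indicator (\<Otimes>\<^bsub>polytope_group\<^esub>j\<in>I. polytope_class (A j)) x = (\<Sum>j\<in>I. indicator (A j) x)"
    using insert by simp
  have ind: "AE x in lebesgue. polytope_group_indicator (polytope_class (A i)) x = indicator (A i) x"
    using insert.prems by (intro polytope_group_indicator_class) simp
  from split IH ind show ?case
    by eventually_elim (simp add: insert.hyps)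
qed

text \<open>Two functions that agree almost everywhere have periodizations that agree almost everywhere, as
  the lattice is countable; reflecting the lattice turns \<open>x - l\<close> into \<open>l + x\<close>.\<close>
lemma multi_tiles_AE:
  assumes "multi_tiles Q" and g: "AE x in lebesgue. polytope_group_indicator Q x = g x"
  obtains k :: int where "AE y in lebesgue. (\<Sum>\<^sub>\<infinity>l\<in>integer_lattice. g (l + y)) = of_int k"
proof -
  obtain k :: int where k: "AE x in lebesgue.
      (\<Sum>\<^sub>\<infinity>l\<in>integer_lattice. polytope_group_indicator Q (x - l)) = of_int k"
    using assms(1) by (auto simp: multi_tiles_def)
  have "AE y in lebesgue. \<forall>l\<in>integer_lattice. polytope_group_indicator Q (l + y) = g (l + y)"
    using AE_lebesgue_affine[OF g, of 1]
    by (intro AE_ball_countable' countable_integer_lattice) auto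
  then have "AE y in lebesgue. (\<Sum>\<^sub>\<infinity>l\<in>integer_lattice. g (l + y)) = of_int k"
    using k
  proof eventually_elim
    case (elim y)
    have "polytope_group_indicator Q (y - l) = g (y - l)" if "l \<in> integer_lattice" for l
      using elim(1)[rule_format, OF integer_lattice_uminus[OF that]] by simp
    then have "(\<Sum>\<^sub>\<infinity>l\<in>integer_lattice. polytope_group_indicator Q (y - l))
        = (\<Sum>\<^sub>\<infinity>l\<in>integer_lattice. g (y - l))" by (rule infsum_cong)
    also have "\<dots> = (\<Sum>\<^sub>\<infinity>l\<in>integer_lattice. g (l + y))"
      by (rule infsum_reindex_bij_witness[of _ uminus uminus])
        (auto simp: integer_lattice_uminus)
    finally show ?case using elim by simp
  qed
  with that show ?thesis by blast
qed

lemma lattice_ball_sum_hyperoctahedral: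
  fixes \<gamma> :: "real^'n^'n"
  assumes "\<gamma> \<in> hyperoctahedral" "S \<in> sets borel"
  shows "(\<Sum>\<^sub>\<infinity>l\<in>integer_lattice. measure lebesgue (ball l \<epsilon> \<inter> (*v) \<gamma> ` S))
       = (\<Sum>\<^sub>\<infinity>l\<in>integer_lattice. measure lebesgue (ball l \<epsilon> \<inter> S))"
proof -
  note orth = orthogonal_transformation_hyperoctahedral[OF assms(1)]
  have "measure lebesgue (ball (\<gamma> *v l) \<epsilon> \<inter> (*v) \<gamma> ` S) = measure lebesgue (ball l \<epsilon> \<inter> S)" for l
  proof -
    have "ball (\<gamma> *v l) \<epsilon> \<inter> (*v) \<gamma> ` S = (*v) \<gamma> ` (ball l \<epsilon> \<inter> S)"
      using image_orthogonal_transformation_ball[OF orth, of l \<epsilon>] orthogonal_transformation_inj[OF orth]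
      by (simp add: image_Int)
    then show ?thesis
      using assms by (simp add: measure_hyperoctahedral_image)
  qed
  then show ?thesis
    using infsum_reindex_bij_betw[OF bij_betw_hyperoctahedral_lattice[OF assms(1)],
        of "\<lambda>l. measure lebesgue (ball l \<epsilon> \<inter> (*v) \<gamma> ` S)"]
    by simp
qed

theorem theorem8p4:
  fixes P :: "(real^'n) set" and t :: nat
  assumes "rational_polytope P"
    and "multi_tiles
           (\<Otimes>\<^bsub>polytope_group\<^esub>\<gamma>\<in>hyperoctahedral. polytope_class ((\<lambda>x. \<gamma> *v x) ` P))"
    and "t > 0"
  shows "solid_angle_sum P (real t) = measure lebesgue P * real t ^ CARD('n)"
proof -
  let ?B = "hyperoctahedral :: (real^'n^'n) set"
  let ?g = "\<lambda>z. \<Sum>\<gamma>\<in>?B. indicator ((*v) \<gamma> ` P) z :: real"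
  let ?b = "real (card ?B)"
  let ?tP = "(*\<^sub>R) (real t) ` P"
  have poly: "polytope P" using assms(1) by (simp add: rational_polytope_def)
  have polyB: "polytope ((*v) \<gamma> ` P)" for \<gamma> :: "real^'n^'n"
    by (intro polytope_linear_image poly matrix_vector_mul_linear)
  have cvx: "convex ?tP" and cpt: "compact ?tP"
    using poly by (auto intro: convex_scaling compact_scaling polytope_imp_convex polytope_imp_compact)
  have b: "?b > 0" by (simp add: card_hyperoctahedral)
  obtain k :: int where k: "AE y in lebesgue. (\<Sum>\<^sub>\<infinity>l\<in>integer_lattice. ?g (l + y)) = of_int k"
    using multi_tiles_AE[OF assms(2) polytope_group_indicator_finprod]
      finite_hyperoctahedral polyB polytope_in_polytope_unions by blast

  \<comment> \<open>Unit cubes: the number \<open>k\<close> is the total volume of the images of \<open>P\<close>.\<close>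
  have vol: "of_int k = ?b * measure lebesgue P"
  proof -
    define C where "C = {y :: real^'n. \<forall>i. 0 \<le> y $ i \<and> y $ i < 1}"
    note C = unit_cube[where 'n = 'n, folded C_def]
    have "measure lebesgue ((*v) \<gamma> ` P) = measure lebesgue P" if "\<gamma> \<in> ?B" for \<gamma>
      using that poly by (intro measure_hyperoctahedral_image)
        (auto intro!: borel_closed polytope_imp_closed)
    then have "(\<Sum>\<gamma>\<in>?B. \<Sum>\<^sub>\<infinity>l\<in>integer_lattice. measure lebesgue ((+) l ` C \<inter> (*v) \<gamma> ` P))
        = (\<Sum>\<gamma>\<in>?B. measure lebesgue P)"
      using polyB unfolding C_def
      by (intro sum.cong refl) (simp add: sum_measure_unit_cubes lmeasurable_compact
          polytope_imp_compact polytope_imp_bounded)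
    moreover have "(\<Sum>\<gamma>\<in>?B. \<Sum>\<^sub>\<infinity>l\<in>integer_lattice. measure lebesgue ((+) l ` C \<inter> (*v) \<gamma> ` P))
        = of_int k * measure lebesgue C"
      by (intro integral_periodization[OF finite_hyperoctahedral _ _ C(1,2) k] lmeasurable_compact
          polytope_imp_compact polytope_imp_bounded polyB)
    ultimately show ?thesis using C by simp
  qed

  \<comment> \<open>Balls, applied to the dilated polytope.\<close>
  have "{z. ?g z \<noteq> 0} \<subseteq> (\<Union>\<gamma>\<in>?B. (*v) \<gamma> ` P)"
    by (auto elim!: sum.not_neutral_contains_not_neutral simp: indicator_def split: if_splits)
  moreover have "bounded (\<Union>\<gamma>\<in>?B. (*v) \<gamma> ` P)"
    using polyB finite_hyperoctahedral by (auto intro: polytope_imp_bounded)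
  ultimately have "bounded {z. ?g z \<noteq> 0}" by (rule bounded_subset[rotated])
  from AE_periodization_dilate[OF this assms(3) k]
  have kt: "AE y in lebesgue. (\<Sum>\<^sub>\<infinity>l\<in>integer_lattice. \<Sum>\<gamma>\<in>?B. indicator ((*v) \<gamma> ` ?tP) (l + y))
      = of_int k * real t ^ CARD('n)"
  proof eventually_elim
    case (elim y)
    have "indicator ((*v) \<gamma> ` ?tP) z = (indicator ((*v) \<gamma> ` P) ((1 / real t) *\<^sub>R z) :: real)"
      for z and \<gamma> :: "real^'n^'n"
    proof -
      have "z \<in> (*v) \<gamma> ` ?tP \<longleftrightarrow> z \<in> (*\<^sub>R) (real t) ` (*v) \<gamma> ` P"
        by (simp add: image_image matrix_vector_mult_scaleR)
      also have "\<dots> \<longleftrightarrow> (1 / real t) *\<^sub>R z \<in> (*v) \<gamma> ` P"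
      proof
        assume "(1 / real t) *\<^sub>R z \<in> (*v) \<gamma> ` P"
        moreover have "z = real t *\<^sub>R ((1 / real t) *\<^sub>R z)" using assms(3) by simp
        ultimately show "z \<in> (*\<^sub>R) (real t) ` (*v) \<gamma> ` P" by (rule rev_image_eqI)
      qed (use assms(3) in auto)
      finally show ?thesis by (simp add: indicator_def)
    qed
    with elim show ?case by simp
  qed
  have "(\<Sum>\<^sub>\<infinity>l\<in>integer_lattice. measure lebesgue (ball l \<epsilon> \<inter> ?tP)) / measure lebesgue (ball (0::real^'n) \<epsilon>)
      = measure lebesgue P * real t ^ CARD('n)" if "\<epsilon> > 0" for \<epsilon>
  proof -
    have "?b * (\<Sum>\<^sub>\<infinity>l\<in>integer_lattice. measure lebesgue (ball l \<epsilon> \<inter> ?tP))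
        = (\<Sum>\<gamma>\<in>?B. \<Sum>\<^sub>\<infinity>l\<in>integer_lattice. measure lebesgue (ball l \<epsilon> \<inter> (*v) \<gamma> ` ?tP))"
      using cpt by (simp add: lattice_ball_sum_hyperoctahedral borel_compact)
    also have "\<dots> = (\<Sum>\<gamma>\<in>?B. \<Sum>\<^sub>\<infinity>l\<in>integer_lattice. measure lebesgue ((+) l ` ball 0 \<epsilon> \<inter> (*v) \<gamma> ` ?tP))"
      by (simp add: ball_translation[symmetric])
    also have "\<dots> = of_int k * real t ^ CARD('n) * measure lebesgue (ball (0::real^'n) \<epsilon>)"
      by (intro integral_periodization[OF finite_hyperoctahedral _ _ _ _ kt] lmeasurable_compact
          compact_imp_bounded compact_continuous_image linear_continuous_on
          matrix_vector_mul_bounded_linear cpt lmeasurable_ball bounded_ball)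
    finally show ?thesis
      using b that by (simp add: vol field_simps)
  qed
  then have "\<forall>\<^sub>F \<epsilon> in at_right 0. (\<Sum>\<^sub>\<infinity>l\<in>integer_lattice. measure lebesgue (ball l \<epsilon> \<inter> ?tP))
      / measure lebesgue (ball (0::real^'n) \<epsilon>) = measure lebesgue P * real t ^ CARD('n)"
    by (intro eventually_mono[OF eventually_at_right_less]) auto
  then show ?thesis
    unfolding solid_angle_sum_def
    by (intro tendsto_unique[OF _ lattice_ball_sum_tendsto[OF cvx cpt] tendsto_eventually]) auto
qed

end
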